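(* Let $\mathcal{P}$ be a plan for an $s^m$ experiment on $b$ blocks of size $k$ each, let $V$ be a vector subspace of $F^m$, and let $V(\mathcal{P})$ be the expansion of $\mathcal{P}$ along $V$. Fix a pair of effects $E_a$ and $E_b$. (a) If $E_a$ and $E_b$ are from different effects classes relative to $V$, then $E_a \bot E_b\,(bl)$ in $V(\mathcal{P})$. (b) Suppose $E_a$ and $E_b$ are from the same effects class relative to $V$. Then the following hold. (i) If both $a$ and $b$ are in $V^{\bot}$, then the relation between $E_a$ and $E_b$ in $V(\mathcal{P})$ is the same as that in $\mathcal{P}$; that is, $E_a$ is confounded with, non-orthogonal to, or orthogonal to $E_b$ (through the block factor) in $V(\mathcal{P})$ if it is so in $\mathcal{P}$. (ii) If neither $a$ nor $b$ is in $V^{\bot}$ and $E_a$ is aliased with $E_b$ in $\mathcal{P}$, then $E_a$ and $E_b$ are no longer aliased in $V(\mathcal{P})$, provided $V$ is non-trivial.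
   Context: $s$ is a prime power, $F$ is the field of order $s$, and $F^m$ is the space of column vectors of length $m$ over $F$. A run (level combination) of an $s^m$ experiment is a vector $x\in F^m$. A plan $\mathcal{P}$ on $b$ blocks of size $k$ is a collection of $b$ blocks $B_1,\dots,B_b$, each consisting of $k$ runs (runs may repeat). For $a\in F^m\setminus\{0\}$, $E_a$ is the factorial effect (main effect or interaction) corresponding to $a$; $E_a=E_{pa}$ for $p\in F\setminus\{0\}$. Run $x$ is at level $t\in F$ of $E_a$ if $a'x=t$. For effects $E_a,E_b$: $N^{ab}$ is the $s\times s$ matrix whose $(\alpha,\beta)$ entry is the number of runs $x$ in the plan with $a'x=\alpha$ and $b'x=\beta$; $L^a$ is the $s\times(\text{number of blocks})$ matrix whose $(\alpha,j)$ entry is the number of runs $x$ in the $j$th block with $a'x=\alpha$. $E_a$ and $E_b$ are orthogonal through the block factor, written $E_a\bot E_b\,(bl)$, if $kN^{ab}=L^a(L^b)'$; "orthogonal" always means orthogonal through the block factor. Two distinct effects $E_a,E_b$ are aliased (confounded with each other) in a plan if, over all runs of the plan, the level of each determines the level of the other, i.e. after a suitable permutation of rows and columns $N^{ab}$ is diagonal. Let $V$ be a vector subspace of $F^m$ of dimension $t\ge1$. For a block $B$ and $v\in V$ let $v+B=\{v+x:x\in B\}$. The expansion $V(\mathcal{P})$ of $\mathcal{P}$ along $V$ is the plan with $bs^t$ blocks of size $k$ whose blocks are $v+B_j$, $v\in V$, $1\le j\le b$. $V^{\bot}=\{w\in F^m: w'v=0\ \forall v\in V\}$. $\langle a\rangle$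 denotes the subspace of $F^m$ spanned by $a$. The effects classes relative to $V$ are the equivalence classes of the relation $E_a\sim_V E_b$ iff $\langle a\rangle+V^{\bot}=\langle b\rangle+V^{\bot}$.
   Formalization: Part (b)(ii) is false as printed (one block {t e1}, V=<e1>, a=e1, b=e1+e2 stay aliased); the formal version adds that each nonzero w in V^⊥ ∩ span{a,b} takes at least two levels w'x over the runs of P. *)

theory Defs
  imports "HOL-Analysis.Analysis"
begin

text \<open>
  The field \<open>F\<close> of prime power order \<open>s\<close> is a finite field type \<open>'f\<close>, so \<open>s = CARD('f)\<close>, and
  \<open>F\<^sup>m\<close> is \<open>'f ^ 'm\<close> with \<open>m = CARD('m)\<close>. The product \<open>a'x\<close> is \<^const>\<open>scalar_product\<close>. Since
  \<open>'f\<close> is an arbitrary field, spans, subspaces and dimensions are those of the \<open>vec\<close>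
  interpretation (\<^const>\<open>vec.span\<close>, \<^const>\<open>vec.subspace\<close>, \<^const>\<open>vec.dim\<close>), not the real ones.
\<close>

text \<open>
  The blocks form a family of multisets of runs, indexed by a finite set: equal blocks may occur
  for different indices, and the columns of the matrices \<open>L\<^sup>a\<close> are indexed by that set.
\<close>

record ('j, 'f, 'm::finite) plan =
  index :: "'j set"
  block :: "'j \<Rightarrow> ('f ^ 'm) multiset"

definition is_plan :: "('j, 'f, 'm::finite) plan \<Rightarrow> nat \<Rightarrow> nat \<Rightarrow> bool" where
  "is_plan P b k \<longleftrightarrow>
     finite (index P) \<and> card (index P) = b \<and> (\<forall>j\<in>index P. size (block P j) = k)"

definition runs :: "('j, 'f, 'm::finite) plan \<Rightarrow> ('f ^ 'm) set" where
  "runs P = (\<Union>j\<in>index P. set_mset (block P j))"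

text \<open>
  An effect \<open>E\<^sub>a\<close> is represented by a nonzero vector \<open>a\<close>; two such vectors give the same effect iff
  they are proportional.
\<close>

definition same_effect :: "'f::field ^ 'm::finite \<Rightarrow> 'f ^ 'm \<Rightarrow> bool" where
  "same_effect a b \<longleftrightarrow> (\<exists>p. p \<noteq> 0 \<and> b = p *s a)"

definition N_mat ::
  "('j, 'f::{field,finite}, 'm::finite) plan \<Rightarrow> 'f ^ 'm \<Rightarrow> 'f ^ 'm \<Rightarrow> 'f \<Rightarrow> 'f \<Rightarrow> nat" where
  "N_mat P a b \<alpha> \<beta> =
     (\<Sum>j\<in>index P. size {#x \<in># block P j. scalar_product a x = \<alpha> \<and> scalar_product b x = \<beta>#})"

definition L_mat ::
  "('j, 'f::{field,finite}, 'm::finite) plan \<Rightarrow> 'f ^ 'm \<Rightarrow> 'f \<Rightarrow> 'j \<Rightarrow> nat" where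
  "L_mat P a \<alpha> j = size {#x \<in># block P j. scalar_product a x = \<alpha>#}"

definition orthogonal_bl ::
  "nat \<Rightarrow> ('j, 'f::{field,finite}, 'm::finite) plan \<Rightarrow> 'f ^ 'm \<Rightarrow> 'f ^ 'm \<Rightarrow> bool" where
  "orthogonal_bl k P a b \<longleftrightarrow>
     (\<forall>\<alpha> \<beta>. k * N_mat P a b \<alpha> \<beta> = (\<Sum>j\<in>index P. L_mat P a \<alpha> j * L_mat P b \<beta> j))"

definition aliased ::
  "('j, 'f::{field,finite}, 'm::finite) plan \<Rightarrow> 'f ^ 'm \<Rightarrow> 'f ^ 'm \<Rightarrow> bool" where
  "aliased P a b \<longleftrightarrow> \<not> same_effect a b \<and>
     (\<forall>x\<in>runs P. \<forall>y\<in>runs P.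
        scalar_product a x = scalar_product a y \<longleftrightarrow> scalar_product b x = scalar_product b y)"

definition perp :: "('f::{field,finite} ^ 'm::finite) set \<Rightarrow> ('f ^ 'm) set" where
  "perp V = {w. \<forall>v\<in>V. scalar_product w v = 0}"

definition expansion ::
  "('f::{field,finite} ^ 'm::finite) set \<Rightarrow> ('j, 'f, 'm) plan \<Rightarrow> (('f ^ 'm) \<times> 'j, 'f, 'm) plan" where
  "expansion V P =
     \<lparr>index = V \<times> index P, block = (\<lambda>(v, j). image_mset (\<lambda>x. v + x) (block P j))\<rparr>"

text \<open>The sum of two subspaces is the elementwise sum of sets.\<close>

definition same_class ::
  "('f::{field,finite} ^ 'm::finite) set \<Rightarrow> 'f ^ 'm \<Rightarrow> 'f ^ 'm \<Rightarrow> bool" where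
  "same_class V a b \<longleftrightarrow> vec.span {a} + perp V = vec.span {b} + perp V"

text \<open>
  \<open>E\<^sub>w\<close> has a single level on all runs of \<open>P\<close>. Suppose \<open>b = p a + w\<close> with \<open>p \<noteq> 0\<close>, \<open>w \<in> V\<^sup>\<bottom>\<close>,
  \<open>w \<noteq> 0\<close>. If \<open>E\<^sub>w\<close> has a single level \<open>c\<close> on \<open>P\<close>, then \<open>b'x = p a'x + c\<close> for all runs \<open>x\<close> of \<open>P\<close>
  and of \<open>V(P)\<close>, so \<open>E\<^sub>a\<close> and \<open>E\<^sub>b\<close> stay aliased in \<open>V(P)\<close>. The claim that the expansion removes
  an alias therefore needs the case to be excluded.
\<close>

definition single_level ::
  "('j, 'f::{field,finite}, 'm::finite) plan \<Rightarrow> 'f ^ 'm \<Rightarrow> bool" where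
  "single_level P w \<longleftrightarrow> (\<exists>c. \<forall>x\<in>runs P. scalar_product w x = c)"

end

theory Submission
  imports Defs
begin

text \<open>
  If \<open>b \<notin> \<langle>a\<rangle> + V\<^sup>\<bottom>\<close>, some \<open>u \<in> V\<close> with \<open>a'u = 0\<close> attains any prescribed value \<open>b'u\<close>.
  Translating by \<open>u\<close> shows that the number of \<open>v \<in> V\<close> with \<open>a'(v + x) = \<alpha>\<close> and
  \<open>b'(v + y) = \<beta>\<close> does not depend on \<open>y\<close>. Summing over the pairs \<open>x, y\<close> of a block, the entries of
  \<open>L\<^sup>a(L\<^sup>b)'\<close> therefore equal those with \<open>y\<close> replaced by \<open>x\<close>, taken \<open>k\<close> times, i.e. \<open>k N\<^sup>a\<^sup>b\<close>.
  If \<open>a\<close> and \<open>b\<close> lie in \<open>V\<^sup>\<bottom>\<close>, the expansion just repeats each block \<open>|V|\<close> times as far as the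
  levels are concerned. If \<open>b = p a + w\<close> with \<open>w \<in> V\<^sup>\<bottom>\<close>, and \<open>E\<^sub>w\<close> separates two runs \<open>x\<close>, \<open>y\<close>,
  a translate \<open>v + x\<close> can be given the same level of \<open>E\<^sub>a\<close> as \<open>y\<close>; its level of \<open>E\<^sub>b\<close> differs from
  that of \<open>y\<close>.
\<close>

section \<open>Linear functionals on \<open>V\<close> and effects classes\<close>

lemma scalar_product_add_right:
  "scalar_product a (x + y) = scalar_product a x + scalar_product a (y :: 'f::field ^ 'm::finite)"
  by (simp add: scalar_product_def sum.distrib algebra_simps)

lemma scalar_product_add_left:
  "scalar_product (x + y) a = scalar_product x a + scalar_product (y :: 'f::field ^ 'm::finite) a"
  by (simp add: scalar_product_def sum.distrib algebra_simps)

lemma scalar_product_diff_right: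
  "scalar_product a (x - y) = scalar_product a x - scalar_product a (y :: 'f::field ^ 'm::finite)"
  by (simp add: scalar_product_def sum_subtractf algebra_simps)

lemma scalar_product_scale_right:
  "scalar_product a (c *s x) = c * scalar_product a (x :: 'f::field ^ 'm::finite)"
  by (simp add: scalar_product_def sum_distrib_left algebra_simps)

lemma scalar_product_scale_left:
  "scalar_product (c *s a) x = c * scalar_product a (x :: 'f::field ^ 'm::finite)"
  by (simp add: scalar_product_def sum_distrib_left algebra_simps)

lemma scalar_product_zero_right: "scalar_product a (0 :: 'f::field ^ 'm::finite) = 0"
  by (simp add: scalar_product_def)

lemma scalar_product_zero_left: "scalar_product (0 :: 'f::field ^ 'm::finite) a = 0"
  by (simp add: scalar_product_def)

lemmas scalar_product_simps =
  scalar_product_add_right scalar_product_add_left scalar_product_diff_right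
  scalar_product_scale_right scalar_product_scale_left
  scalar_product_zero_right scalar_product_zero_left

lemma subspace_perp: "vec.subspace (perp V)"
  by (auto simp: vec.subspace_def perp_def scalar_product_simps)

lemma scalar_product_perp: "w \<in> perp V \<Longrightarrow> v \<in> V \<Longrightarrow> scalar_product w v = 0"
  by (simp add: perp_def)

lemma mem_span_perp_iff:
  "b \<in> vec.span {a} + perp V \<longleftrightarrow> (\<exists>p. \<exists>w\<in>perp V. b = p *s a + w)"
  by (auto simp: set_plus_def vec.span_singleton)

lemma span_perp_mono:
  assumes "b \<in> vec.span {a} + perp V"
  shows "vec.span {b} + perp V \<subseteq> vec.span {a} + perp V"
proof
  fix z assume "z \<in> vec.span {b} + perp V"
  then obtain q w where w: "w \<in> perp V" and z: "z = q *s b + w"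
    using mem_span_perp_iff by blast
  obtain p w' where w': "w' \<in> perp V" and b: "b = p *s a + w'"
    using assms mem_span_perp_iff by blast
  have "z = (q * p) *s a + (q *s w' + w)"
    by (simp add: z b vec.scale_right_distrib add.assoc)
  moreover have "q *s w' + w \<in> perp V"
    using w w' subspace_perp by (blast intro: vec.subspace_add vec.subspace_scale)
  ultimately show "z \<in> vec.span {a} + perp V"
    using mem_span_perp_iff by blast
qed

text \<open>If both memberships held, \<open>span_perp_mono\<close> would give both inclusions.
  Which of the two fails is not determined, hence the two cases.\<close>

lemma not_same_class_cases:
  assumes "\<not> same_class V a b"
  obtains "b \<notin> vec.span {a} + perp V" | "a \<notin> vec.span {b} + perp V"
  using assms span_perp_mono[of b a V] span_perp_mono[of a b V]
  unfolding same_class_def by blast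

lemma attain_value:
  assumes V: "vec.subspace V" and a: "a \<notin> perp V"
  obtains v where "v \<in> V" and "scalar_product a v = c"
proof -
  obtain u where u: "u \<in> V" "scalar_product a u \<noteq> 0"
    using a by (auto simp: perp_def)
  show thesis
  proof
    show "(c / scalar_product a u) *s u \<in> V"
      using V u(1) by (rule vec.subspace_scale)
    show "scalar_product a ((c / scalar_product a u) *s u) = c"
      using u(2) by (simp add: scalar_product_simps)
  qed
qed

text \<open>A functional vanishing on the kernel of another one is a multiple of it. If
  \<open>b\<close> vanished on the part of \<open>V\<close> where \<open>a\<close> vanishes, it
  would agree on \<open>V\<close> with a multiple of \<open>a\<close>, against the assumption. So
  \<open>attain_value\<close> applies to that kernel in place of \<open>V\<close>.\<close>

lemma attain_value_in_kernel:
  assumes V: "vec.subspace V" and b: "b \<notin> vec.span {a} + perp V"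
  obtains u where "u \<in> V" and "scalar_product a u = 0" and "scalar_product b u = c"
proof -
  have K: "vec.subspace {v \<in> V. scalar_product a v = 0}" (is "vec.subspace ?K")
    using V by (auto simp: vec.subspace_def scalar_product_simps)
  have "b \<notin> perp ?K"
  proof
    assume bK: "b \<in> perp ?K"
    have "b \<in> vec.span {a} + perp V"
    proof (cases "a \<in> perp V")
      case True
      then have "?K = V" by (auto simp: perp_def)
      with bK have "b = 0 *s a + b" "b \<in> perp V" by auto
      then show ?thesis using mem_span_perp_iff by blast
    next
      case False
      obtain u where u: "u \<in> V" "scalar_product a u = 1"
        using attain_value[OF V False] by blast
      \<comment> \<open>Since \<open>a'u = 1\<close>, the only multiple of \<open>a\<close> that can
        agree with \<open>b\<close> on \<open>V\<close> has the factor \<open>b'u\<close>.\<close>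
      define w where "w = b + (- scalar_product b u) *s a"
      have "w \<in> perp V"
        unfolding perp_def
      proof (intro CollectI ballI)
        fix v assume v: "v \<in> V"
        \<comment> \<open>The projection of \<open>v\<close> along \<open>u\<close> onto the kernel
          of \<open>a\<close>, where \<open>b\<close> vanishes.\<close>
        have "v + (- scalar_product a v) *s u \<in> V"
          using V v vec.subspace_scale[OF V u(1)] by (rule vec.subspace_add)
        moreover have "scalar_product a (v + (- scalar_product a v) *s u) = 0"
          unfolding scalar_product_simps u(2) by simp
        ultimately have "v + (- scalar_product a v) *s u \<in> ?K" by blast
        then have "scalar_product b (v + (- scalar_product a v) *s u) = 0"
          using bK by (rule scalar_product_perp[rotated])
        then show "scalar_product w v = 0"
          unfolding w_def scalar_product_simps by (simp add: algebra_simps)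
      qed
      moreover have "b = scalar_product b u *s a + w"
        by (simp add: w_def)
      ultimately show ?thesis using mem_span_perp_iff by blast
    qed
    with b show False ..
  qed
  from attain_value[OF K this, of c] show thesis using that by blast
qed

section \<open>Double counting in multisets of runs\<close>

lemma sum_size_filter_mset:
  assumes "finite V"
  shows "(\<Sum>v\<in>V. size {#x \<in># M. R v x#}) = (\<Sum>x\<in>#M. card {v \<in> V. R v x})"
proof (induction M)
  case (add x M)
  have "(\<Sum>v\<in>V. size {#y \<in># add_mset x M. R v y#}) =
      (\<Sum>v\<in>V. (if R v x then 1 else 0) + size {#y \<in># M. R v y#})"
    by (rule sum.cong) auto
  also have "\<dots> = card {v \<in> V. R v x} + (\<Sum>v\<in>V. size {#y \<in># M. R v y#})"
    using assms by (simp add: sum.distrib sum.If_cases Int_def)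
  finally show ?case using add by simp
qed simp

text \<open>Both sides count triples \<open>(v, x, y)\<close> with \<open>R v x\<close> and
  \<open>S v y\<close>, runs taken with multiplicity. In the induction, the triples through the new
  \<open>x\<close> are counted by the previous lemma.\<close>

lemma sum_size_filter_mset_mult:
  assumes "finite V"
  shows "(\<Sum>v\<in>V. size {#x \<in># M. R v x#} * size {#y \<in># N. S v y#}) =
    (\<Sum>x\<in>#M. \<Sum>y\<in>#N. card {v \<in> V. R v x \<and> S v y})"
proof (induction M)
  case (add x M)
  have "(\<Sum>v\<in>V. size {#y \<in># add_mset x M. R v y#} * size {#y \<in># N. S v y#}) =
      (\<Sum>v\<in>V. size {#y \<in># N. R v x \<and> S v y#} + size {#y \<in># M. R v y#} * size {#y \<in># N. S v y#})"
    by (rule sum.cong) auto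
  then show ?case
    using add by (simp add: sum.distrib sum_size_filter_mset[OF assms, where M = N and R = "\<lambda>v y. R v x \<and> S v y"])
qed simp

section \<open>Matrices and runs of the expansion\<close>

lemma index_expansion: "index (expansion V P) = V \<times> index P"
  by (simp add: expansion_def)

lemma N_mat_expansion:
  "N_mat (expansion V P) a b \<alpha> \<beta> = (\<Sum>j\<in>index P. \<Sum>v\<in>V.
     size {#x \<in># block P j. scalar_product a (v + x) = \<alpha> \<and> scalar_product b (v + x) = \<beta>#})"
  unfolding N_mat_def index_expansion
  \<comment> \<open>The blocks of \<open>P\<close> are outermost in the statement, so that later
    arguments can treat all translates of one block together; the swap restores the order of the
    index pairs.\<close>
  by (subst sum.swap)
    (simp add: sum.cartesian_product expansion_def filter_mset_image_mset case_prod_unfold)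

lemma L_mat_expansion:
  "L_mat (expansion V P) a \<alpha> (v, j) = size {#x \<in># block P j. scalar_product a (v + x) = \<alpha>#}"
  by (simp add: L_mat_def expansion_def filter_mset_image_mset)

lemma L_mat_mult_expansion:
  "(\<Sum>i\<in>index (expansion V P). L_mat (expansion V P) a \<alpha> i * L_mat (expansion V P) b \<beta> i) =
   (\<Sum>j\<in>index P. \<Sum>v\<in>V. size {#x \<in># block P j. scalar_product a (v + x) = \<alpha>#} *
      size {#x \<in># block P j. scalar_product b (v + x) = \<beta>#})"
  unfolding index_expansion
  by (subst sum.swap) (auto simp: sum.cartesian_product L_mat_expansion intro: sum.cong)

lemma runs_expansion: "runs (expansion V P) = {v + x |v x. v \<in> V \<and> x \<in> runs P}"
  by (fastforce simp: runs_def expansion_def)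

lemma runs_subset_expansion:
  assumes "vec.subspace V"
  shows "runs P \<subseteq> runs (expansion V P)"
proof
  fix x assume "x \<in> runs P"
  moreover have "x = 0 + x" by simp
  ultimately show "x \<in> runs (expansion V P)"
    using vec.subspace_0[OF assms] unfolding runs_expansion by blast
qed

section \<open>Orthogonality and aliasing in the expansion\<close>

lemma orthogonal_bl_sym: "orthogonal_bl k P a b \<longleftrightarrow> orthogonal_bl k P b a"
proof -
  have "N_mat P a b \<alpha> \<beta> = N_mat P b a \<beta> \<alpha>" for \<alpha> \<beta>
    by (simp add: N_mat_def conj_commute)
  then show ?thesis
    unfolding orthogonal_bl_def by (auto simp: mult.commute)
qed

text \<open>With \<open>a'u = 0\<close> and \<open>b'u = b'y - b'x\<close>, the map
  \<open>v \<mapsto> v + u\<close> is a bijection from the first set onto the second.\<close>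

lemma card_translate_levels:
  assumes V: "vec.subspace V" and b: "b \<notin> vec.span {a} + perp V"
  shows "card {v \<in> V. scalar_product a (v + x) = \<alpha> \<and> scalar_product b (v + y) = \<beta>} =
    card {v \<in> V. scalar_product a (v + x) = \<alpha> \<and> scalar_product b (v + x) = \<beta>}"
proof -
  obtain u where u: "u \<in> V" "scalar_product a u = 0"
      "scalar_product b u = scalar_product b y - scalar_product b x"
    using attain_value_in_kernel[OF V b] by blast
  show ?thesis
    by (rule bij_betw_same_card[of "\<lambda>v. v + u"], rule bij_betw_byWitness[where f' = "\<lambda>v. v - u"])
      (use V u in \<open>auto simp: scalar_product_simps
        vec.subspace_add dest: vec.subspace_diff[OF V _ u(1)]\<close>)
qed

lemma orthogonal_bl_expansion:
  assumes P: "is_plan P n k" and V: "vec.subspace V" and b: "b \<notin> vec.span {a} + perp V"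
  shows "orthogonal_bl k (expansion V P) a b"
  unfolding orthogonal_bl_def L_mat_mult_expansion N_mat_expansion
proof (intro allI, subst sum_distrib_left, intro sum.cong refl)
  fix \<alpha> \<beta> j
  assume "j \<in> index P"
  then have k: "size (block P j) = k" using P by (simp add: is_plan_def)
  have fin: "finite V" by simp
  let ?B = "block P j"
  let ?c = "\<lambda>x y. card {v \<in> V. scalar_product a (v + x) = \<alpha> \<and> scalar_product b (v + y) = \<beta>}"
  \<comment> \<open>The factor \<open>k\<close> becomes a sum over a dummy run \<open>y\<close> of
    the same block.\<close>
  have "k * (\<Sum>v\<in>V. size {#x \<in># ?B. scalar_product a (v + x) = \<alpha> \<and> scalar_product b (v + x) = \<beta>#}) =
      (\<Sum>x\<in>#?B. \<Sum>y\<in>#?B. ?c x x)"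
    unfolding sum_size_filter_mset[OF fin] by (simp add: k sum_mset_distrib_left)
  also have "\<dots> = (\<Sum>x\<in>#?B. \<Sum>y\<in>#?B. ?c x y)"
    by (intro arg_cong[where f = sum_mset] image_mset_cong card_translate_levels[OF V b, symmetric])
  also have "\<dots> = (\<Sum>v\<in>V. size {#x \<in># ?B. scalar_product a (v + x) = \<alpha>#} *
      size {#x \<in># ?B. scalar_product b (v + x) = \<beta>#})"
    unfolding sum_size_filter_mset_mult[OF fin] ..
  finally show "k * (\<Sum>v\<in>V. size {#x \<in># ?B.
        scalar_product a (v + x) = \<alpha> \<and> scalar_product b (v + x) = \<beta>#}) =
      (\<Sum>v\<in>V. size {#x \<in># ?B. scalar_product a (v + x) = \<alpha>#} *
        size {#x \<in># ?B. scalar_product b (v + x) = \<beta>#})" .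
qed

text \<open>Translation by \<open>V\<close> changes no level of \<open>a\<close> or
  \<open>b\<close>, so both sides of the defining equation are multiplied by \<open>card V\<close>,
  which is positive and cancels.\<close>

lemma orthogonal_bl_expansion_perp:
  assumes V: "vec.subspace V" and a: "a \<in> perp V" and b: "b \<in> perp V"
  shows "orthogonal_bl k (expansion V P) a b \<longleftrightarrow> orthogonal_bl k P a b"
proof -
  have ne: "V \<noteq> {}" using vec.subspace_0[OF V] by blast
  have N: "N_mat (expansion V P) a b \<alpha> \<beta> = card V * N_mat P a b \<alpha> \<beta>" for \<alpha> \<beta>
    unfolding N_mat_expansion N_mat_def[of P]
    by (simp add: scalar_product_simps scalar_product_perp[OF a] scalar_product_perp[OF b]
        sum_distrib_left cong: sum.cong)
  have L: "(\<Sum>i\<in>index (expansion V P).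
        L_mat (expansion V P) a \<alpha> i * L_mat (expansion V P) b \<beta> i) =
      card V * (\<Sum>j\<in>index P. L_mat P a \<alpha> j * L_mat P b \<beta> j)" for \<alpha> \<beta>
    unfolding L_mat_mult_expansion L_mat_def[of P]
    by (simp add: scalar_product_simps scalar_product_perp[OF a] scalar_product_perp[OF b]
        sum_distrib_left cong: sum.cong)
  show ?thesis
    unfolding orthogonal_bl_def L N using ne by (simp add: mult.left_commute[of k])
qed

lemma aliased_expansion_perp:
  assumes V: "vec.subspace V" and a: "a \<in> perp V" and b: "b \<in> perp V"
  shows "aliased (expansion V P) a b \<longleftrightarrow> aliased P a b"
proof -
  \<comment> \<open>The pairs of levels occurring in the expansion already occur in
    \<open>P\<close>.\<close>
  have level: "\<exists>x\<in>runs P. scalar_product a z = scalar_product a x \<and>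
      scalar_product b z = scalar_product b x" if "z \<in> runs (expansion V P)" for z
    using that scalar_product_perp[OF a] scalar_product_perp[OF b]
    unfolding runs_expansion by (auto simp: scalar_product_simps)
  show ?thesis
  proof
    assume "aliased (expansion V P) a b"
    then show "aliased P a b"
      using runs_subset_expansion[OF V, of P] unfolding aliased_def by blast
  next
    assume al: "aliased P a b"
    have "scalar_product a y = scalar_product a z \<longleftrightarrow> scalar_product b y = scalar_product b z"
      if "y \<in> runs (expansion V P)" "z \<in> runs (expansion V P)" for y z
      using level[OF that(1)] level[OF that(2)] al unfolding aliased_def by auto
    then show "aliased (expansion V P) a b"
      using al unfolding aliased_def by blast
  qed
qed

text \<open>The hypothesis \<open>levels\<close> is applied to \<open>w = b - p *s a\<close>, hence
  the span of \<open>a\<close> and \<open>b\<close> in it.\<close>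

lemma not_aliased_expansion:
  assumes V: "vec.subspace V" and ab: "same_class V a b"
    and a: "a \<notin> perp V" and b: "b \<notin> perp V" and effects: "\<not> same_effect a b"
    and levels: "\<And>w. w \<in> perp V \<inter> vec.span {a, b} \<Longrightarrow> w \<noteq> 0 \<Longrightarrow> \<not> single_level P w"
  shows "\<not> aliased (expansion V P) a b"
proof
  assume al: "aliased (expansion V P) a b"
  have "0 \<in> perp V" using subspace_perp by (rule vec.subspace_0)
  moreover have "b = 1 *s b + 0" by simp
  ultimately have "b \<in> vec.span {b} + perp V" using mem_span_perp_iff by blast
  then obtain p w where w: "w \<in> perp V" and bw: "b = p *s a + w"
    using ab mem_span_perp_iff unfolding same_class_def by blast
  \<comment> \<open>For \<open>p = 0\<close>, \<open>b = w\<close> would lie in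
    \<open>perp V\<close>; for \<open>w = 0\<close>, \<open>a\<close> and \<open>b\<close> would be
    proportional.\<close>
  have "p \<noteq> 0" using b bw w by auto
  then have "w \<noteq> 0" using effects bw by (auto simp: same_effect_def)
  have "w = b - p *s a" using bw by simp
  then have "w \<in> vec.span {a, b}"
    by (auto intro: vec.span_diff vec.span_scale vec.span_base)
  then have multi: "\<not> single_level P w" using levels w \<open>w \<noteq> 0\<close> by blast
  \<comment> \<open>Without runs, \<open>single_level\<close> would hold vacuously.\<close>
  then obtain x where x: "x \<in> runs P" unfolding single_level_def by blast
  obtain y where y: "y \<in> runs P" "scalar_product w y \<noteq> scalar_product w x"
    using multi unfolding single_level_def by blast
  obtain v where v: "v \<in> V" "scalar_product a v = scalar_product a y - scalar_product a x"
    using attain_value[OF V a] by blast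
  have "v + x \<in> runs (expansion V P)"
    unfolding runs_expansion using v x by blast
  moreover have "y \<in> runs (expansion V P)"
    using runs_subset_expansion[OF V] y by blast
  moreover have "scalar_product a (v + x) = scalar_product a y"
    by (simp add: scalar_product_simps v)
  ultimately have "scalar_product b (v + x) = scalar_product b y"
    using al unfolding aliased_def by blast
  \<comment> \<open>Expanding \<open>b = p *s a + w\<close> on both sides, the terms in
    \<open>a\<close> agree by the choice of \<open>v\<close>, and \<open>w'v = 0\<close>.\<close>
  then have "scalar_product w x = scalar_product w y"
    using scalar_product_perp[OF w v(1)]
    by (simp add: bw scalar_product_simps v algebra_simps)
  with y show False by simp
qed

theorem theorem4p2:
  fixes P :: "('j, 'f::{field,finite}, 'm::finite) plan"
    and V :: "('f ^ 'm) set"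
    and a b :: "'f ^ 'm"
    and nb k :: nat
  assumes "is_plan P nb k"
    and "vec.subspace V" and "1 \<le> vec.dim V"
    and "a \<noteq> 0" and "b \<noteq> 0"
  shows
    "(\<not> same_class V a b \<longrightarrow> orthogonal_bl k (expansion V P) a b) \<and>
     (same_class V a b \<longrightarrow>
        (a \<in> perp V \<and> b \<in> perp V \<longrightarrow>
           (aliased (expansion V P) a b \<longleftrightarrow> aliased P a b) \<and>
           (\<not> orthogonal_bl k (expansion V P) a b \<longleftrightarrow> \<not> orthogonal_bl k P a b) \<and>
           (orthogonal_bl k (expansion V P) a b \<longleftrightarrow> orthogonal_bl k P a b)) \<and>
        (a \<notin> perp V \<and> b \<notin> perp V \<and> aliased P a b \<and> V \<noteq> {0} \<and>
         (\<forall>w \<in> perp V \<inter> vec.span {a, b}. w \<noteq> 0 \<longrightarrow> \<not> single_level P w) \<longrightarrow>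
           \<not> aliased (expansion V P) a b))"
proof (intro conjI impI; (elim conjE)?)
  assume "\<not> same_class V a b"
  then show "orthogonal_bl k (expansion V P) a b"
  proof (cases rule: not_same_class_cases)
    case 1
    then show ?thesis by (rule orthogonal_bl_expansion[OF assms(1,2)])
  next
    case 2
    \<comment> \<open>Here \<open>a\<close> and \<open>b\<close> exchange roles, and symmetry of
      orthogonality brings them back.\<close>
    then have "orthogonal_bl k (expansion V P) b a"
      by (rule orthogonal_bl_expansion[OF assms(1,2)])
    then show ?thesis by (rule orthogonal_bl_sym[THEN iffD1])
  qed
next
  assume "a \<in> perp V" "b \<in> perp V"
  note ab = \<open>vec.subspace V\<close> this
  show "aliased (expansion V P) a b \<longleftrightarrow> aliased P a b"
    using ab by (rule aliased_expansion_perp)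
  show "orthogonal_bl k (expansion V P) a b \<longleftrightarrow> orthogonal_bl k P a b"
    using ab by (rule orthogonal_bl_expansion_perp)
  then show "\<not> orthogonal_bl k (expansion V P) a b \<longleftrightarrow> \<not> orthogonal_bl k P a b"
    by simp
next
  assume "same_class V a b" and "a \<notin> perp V" "b \<notin> perp V" and "aliased P a b"
    and levels: "\<forall>w \<in> perp V \<inter> vec.span {a, b}. w \<noteq> 0 \<longrightarrow> \<not> single_level P w"
  moreover from \<open>aliased P a b\<close> have "\<not> same_effect a b"
    by (simp add: aliased_def)
  ultimately show "\<not> aliased (expansion V P) a b"
    by (intro not_aliased_expansion[OF assms(2)]) (simp_all add: levels)
qed

end
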